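(* There exists a rotational Steiner quadruple system on $46$ points, i.e.\ a Steiner system $S(3,4,46)$ admitting an automorphism that fixes one point and permutes the remaining $45$ points in a single cycle of length $45$.
   Context: A Steiner system $S(t,k,v)$ is a pair $(X,\mathcal{B})$ where $X$ is a set of $v$ points and $\mathcal{B}$ is a family of $k$-element subsets of $X$ (blocks) such that every $t$-subset of $X$ is contained in exactly one block. A Steiner quadruple system $\mathrm{SQS}(v)$ is an $S(3,4,v)$. It is called rotational, written $\mathrm{RoSQS}(v)$, if it has an automorphism (a permutation of $X$ mapping blocks to blocks) that fixes one point and acts as a single cycle of length $v-1$ on the remaining points. *)

theory Defs
  imports "HOL-Combinatorics.Combinatorics"
begin

definition steiner_system :: "nat \<Rightarrow> nat \<Rightarrow> nat \<Rightarrow> 'a set \<Rightarrow> 'a set set \<Rightarrow> bool" where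
  "steiner_system t k v X B \<longleftrightarrow>
     finite X \<and> card X = v \<and>
     (\<forall>b\<in>B. b \<subseteq> X \<and> card b = k) \<and>
     (\<forall>T. T \<subseteq> X \<and> card T = t \<longrightarrow> (\<exists>!b. b \<in> B \<and> T \<subseteq> b))"

abbreviation SQS :: "nat \<Rightarrow> 'a set \<Rightarrow> 'a set set \<Rightarrow> bool" where
  "SQS v \<equiv> steiner_system 3 4 v"

definition design_automorphism :: "'a set \<Rightarrow> 'a set set \<Rightarrow> ('a \<Rightarrow> 'a) \<Rightarrow> bool" where
  "design_automorphism X B p \<longleftrightarrow> p permutes X \<and> (\<forall>b\<in>B. p ` b \<in> B)"

(* The cycle has length v - 1, since card X = v and it consists of all of X - {x}. *)
definition RoSQS :: "nat \<Rightarrow> 'a set \<Rightarrow> 'a set set \<Rightarrow> bool" where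
  "RoSQS v X B \<longleftrightarrow>
     SQS v X B \<and>
     (\<exists>p x. design_automorphism X B p \<and> x \<in> X \<and> p x = x \<and> cyclic_on p (X - {x}))"

end

theory Submission
  imports Defs
begin

text \<open>
  The system was found by computer. Identify the points with \<open>\<int>\<^sub>4\<^sub>5 \<union> {\<infinity>}\<close> and ask for 84 full orbits
  of blocks under translation in addition to the short orbit of \<open>{\<infinity>, 0, 15, 30}\<close>. To cut the
  search space, first choose a few orbits such that the triples not covered by them are closed
  under \<open>x \<mapsto> - x\<close>, and then cover these triples by orbits that are permuted by negation.

  For the verification, every triple has a translate \<open>{0, y, z}\<close> in a normal form, so that it
  suffices to see that each of the 338 normal forms lies in exactly one of the 330 blocks
  through \<open>0\<close>.
\<close>

section \<open>Base blocks, translations and codes of normal forms\<close>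

text \<open>The point \<open>\<infinity>\<close> is encoded as 45.\<close>

definition shift :: "nat \<Rightarrow> nat \<Rightarrow> nat" where
  "shift t x = (if x = 45 then 45 else (x + t) mod 45)"

definition base_blocks :: "nat list list" where
  "base_blocks =
    [[0,1,7,45], [0,2,42,45], [0,4,24,45], [0,8,17,45], [0,10,23,45], [0,11,27,45],
     [0,12,31,45], [0,1,2,43], [0,1,3,39], [0,1,4,29], [0,1,5,24], [0,1,6,20],
     [0,1,8,25], [0,1,9,14], [0,1,10,11], [0,1,12,13], [0,1,15,16], [0,1,17,28],
     [0,1,18,23], [0,1,19,27], [0,1,21,38], [0,1,22,41], [0,1,26,40], [0,1,32,37],
     [0,2,5,10], [0,2,6,8], [0,2,7,20], [0,2,9,21], [0,2,11,36], [0,2,12,17],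
     [0,2,13,28], [0,2,14,32], [0,2,15,33], [0,2,16,25], [0,2,18,24], [0,2,19,34],
     [0,2,22,31], [0,2,23,29], [0,2,26,37], [0,2,27,40], [0,2,30,35], [0,3,6,12],
     [0,3,7,17], [0,3,10,16], [0,3,11,40], [0,3,13,33], [0,3,14,37], [0,3,15,35],
     [0,3,18,21], [0,3,19,29], [0,3,20,34], [0,3,22,25], [0,3,24,36], [0,3,31,41],
     [0,3,32,38], [0,4,8,36], [0,4,9,27], [0,4,10,18], [0,4,11,33], [0,4,12,28],
     [0,4,13,22], [0,4,15,19], [0,4,16,38], [0,4,17,40], [0,4,20,25], [0,4,21,37],
     [0,4,31,39], [0,5,11,39], [0,5,12,20], [0,5,21,34], [0,5,30,38], [0,6,15,21],
     [0,6,18,28], [0,6,19,25], [0,6,23,33], [0,7,14,33], [0,7,16,31], [0,7,18,25],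
     [0,7,21,36], [0,7,22,30], [0,8,19,32], [0,8,21,31], [0,9,19,28], [0,10,20,31]]"

definition blocks :: "nat set set" where
  "blocks = {shift t ` set q | q t. q \<in> set ([0, 15, 30, 45] # base_blocks)}"

text \<open>Shifting by \<open>45 - x\<close> moves the finite point \<open>x\<close> to 0. The
  seven base blocks containing 45 give three blocks through 0 each, the other 77 give four; with the
  short block, whose three such translates coincide, this makes 21 + 308 + 1 = 330.\<close>

definition blocks_at_0 :: "nat list list" where
  "blocks_at_0 = [0, 15, 30, 45] #
     concat (map (\<lambda>q. map (\<lambda>x. map (shift (45 - x)) q) (filter (\<lambda>x. x \<noteq> 45) q)) base_blocks)"

text \<open>
  Translating a triple of residues so that one of its points becomes 0 permutes the three gaps
  \<open>y\<close>, \<open>z - y\<close>, \<open>45 - z\<close> cyclically; the normal form puts a smallest gap first, and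
  the last gap must be strictly larger, unless all gaps are 15.
\<close>

definition normal_pair :: "nat \<Rightarrow> nat \<Rightarrow> bool" where
  "normal_pair y z \<longleftrightarrow> 0 < y \<and> y < z \<and> z \<le> 45 \<and>
     (if z = 45 then y \<le> 22 else 2 * y \<le> z \<and> y + z < 45 \<or> y = 15 \<and> z = 30)"

text \<open>Base 46 keeps the pair recoverable, as \<open>z\<close> is at most 45, and orders codes
  lexicographically. So \<open>codes [0..<46]\<close> is already sorted and can be compared
  literally with the output of a sort.\<close>

definition codes :: "nat list \<Rightarrow> nat list" where
  "codes q = concat (map (\<lambda>y. map (\<lambda>z. 46 * y + z) (filter (normal_pair y) q)) q)"

section \<open>Bottom-up merge sort\<close>

fun merge :: "nat list \<Rightarrow> nat list \<Rightarrow> nat list" where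
  "merge [] ys = ys"
| "merge xs [] = xs"
| "merge (x # xs) (y # ys) = (if x \<le> y then x # merge xs (y # ys) else y # merge (x # xs) ys)"

fun merge_pairs :: "nat list list \<Rightarrow> nat list list" where
  "merge_pairs (xs # ys # xss) = merge xs ys # merge_pairs xss"
| "merge_pairs xss = xss"

text \<open>Termination of \<open>merge_all\<close>: n + 2 lists become 1 + (n + 1) div 2.\<close>

lemma length_merge_pairs [termination_simp]: "length (merge_pairs xss) = (length xss + 1) div 2"
  by (induction xss rule: merge_pairs.induct) auto

fun merge_all :: "nat list list \<Rightarrow> nat list" where
  "merge_all [] = []"
| "merge_all [xs] = xs"
| "merge_all (xs # ys # xss) = merge_all (merge xs ys # merge_pairs xss)"

lemma mset_merge: "mset (merge xs ys) = mset xs + mset ys"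
  by (induction xs ys rule: merge.induct) auto

lemma mset_concat_merge_pairs: "mset (concat (merge_pairs xss)) = mset (concat xss)"
  by (induction xss rule: merge_pairs.induct) (auto simp: mset_merge)

lemma mset_merge_all: "mset (merge_all xss) = mset (concat xss)"
  by (induction xss rule: merge_all.induct)
    (use mset_concat_merge_pairs in \<open>auto simp: mset_merge mset_concat\<close>)

section \<open>Evaluation by the simplifier\<close>

lemma base_blocks_wf:
  "list_all (\<lambda>q. length q = 4 \<and> distinct q \<and> list_all (\<lambda>x. x \<le> 45) q) base_blocks"
  by (simp add: base_blocks_def)

schematic_goal blocks_at_0_eval: "blocks_at_0 = ?xs"
  by (simp add: base_blocks_def blocks_at_0_def shift_def)

schematic_goal codes_at_0_eval: "concat (map codes blocks_at_0) = ?ks"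
  by (simp add: blocks_at_0_eval codes_def normal_pair_def)

text \<open>\<open>upt_rec_numeral\<close> unfolds only numeral bounds, and 0 and 1 are not of that
  form.\<close>

lemma upt_46: "[0..<46] = 0 # 1 # [2..<46]"
  by (simp add: upt_conv_Cons)

schematic_goal all_codes_eval: "codes [0..<46] = ?ks"
  by (simp add: upt_46 codes_def normal_pair_def upt_rec_numeral)

text \<open>The computational core: sorting the codes from all blocks through 0 yields each of the
  338 normal forms once, 22 with the point 45 and 316 without it.\<close>

lemma merge_all_codes:
  "merge_all (map (\<lambda>k. [k]) (concat (map codes blocks_at_0))) = codes [0..<46]"
  by (simp add: codes_at_0_eval all_codes_eval)

section \<open>Translations acting on blocks\<close>

lemma shift_le: "shift t x \<le> 45"
  by (simp add: shift_def)

lemma shift_shift: "shift s (shift t x) = shift (s + t) x"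
  by (auto simp: shift_def mod_simps add_ac)

lemma shift_mod: "shift (t mod 45) x = shift t x"
  by (simp add: shift_def mod_simps)

text \<open>Since 44 is -1 modulo 45, \<open>44 * t\<close> is a natural number representing
  -t.\<close>

lemma shift_inverse: "x \<le> 45 \<Longrightarrow> shift (44 * t) (shift t x) = x"
  by (simp add: shift_shift) (simp add: shift_def)

lemma inj_on_shift: "inj_on (shift t) {..45}"
  by (rule inj_on_inverseI[where g = "shift (44 * t)"]) (simp add: shift_inverse)

lemma base_block_wf:
  assumes "q \<in> set ([0, 15, 30, 45] # base_blocks)"
  shows "set q \<subseteq> {..45}" "card (set q) = 4"
  using assms base_blocks_wf by (auto simp: list_all_iff distinct_card)

lemma block_wf:
  assumes "b \<in> blocks"
  shows "b \<subseteq> {..45}" "card b = 4"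
proof -
  obtain q t where q: "q \<in> set ([0, 15, 30, 45] # base_blocks)" and b: "b = shift t ` set q"
    using assms by (auto simp: blocks_def)
  show "b \<subseteq> {..45}"
    using b shift_le by auto
  show "card b = 4"
    using b base_block_wf[OF q] inj_on_shift inj_on_subset card_image by metis
qed

lemma shift_block: "b \<in> blocks \<Longrightarrow> shift s ` b \<in> blocks"
  unfolding blocks_def by (force simp: image_image shift_shift simp del: list.set)

section \<open>Blocks through 0\<close>

lemma in_blocks_at_0:
  assumes "b \<in> blocks" "0 \<in> b"
  obtains q where "q \<in> set blocks_at_0" "b = set q"
proof -
  obtain q t where q: "q \<in> set ([0, 15, 30, 45] # base_blocks)" and b: "b = shift t ` set q"
    using assms(1) by (auto simp: blocks_def)
  then obtain x where x: "x \<in> set q" "shift t x = 0"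
    using assms(2) by auto
  then have "x < 45" and t: "(x + t) mod 45 = 0"
    using base_block_wf(1)[OF q] by (auto simp: shift_def split: if_splits)
  \<comment> \<open>The translation is forced by the point sent to 0: \<open>t\<close> is congruent
    to -x, expressed as \<open>45 - x\<close> in the naturals.\<close>
  have "t mod 45 = ((45 - x) + (x + t)) mod 45"
    using \<open>x < 45\<close> by simp
  also have "\<dots> = (45 - x) mod 45"
    by (subst mod_add_right_eq[symmetric]) (simp add: t)
  finally have "t mod 45 = (45 - x) mod 45" .
  then have b: "b = shift (45 - x) ` set q"
    unfolding b by (intro image_cong refl) (metis shift_mod)
  show thesis
  proof (cases "q = [0, 15, 30, 45]")
    case True
    \<comment> \<open>Here \<open>x\<close> is 0, 15 or 30, and all three shifts fix the short
      block.\<close>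
    then have "b = set [0, 15, 30, 45]"
      using x(1) \<open>x < 45\<close> unfolding b by (auto simp: shift_def)
    then show thesis
      by (intro that[of "[0, 15, 30, 45]"]) (auto simp: blocks_at_0_def)
  next
    case False
    then have "map (shift (45 - x)) q \<in> set blocks_at_0"
      using q x(1) \<open>x < 45\<close> by (auto simp: blocks_at_0_def)
    then show thesis
      using b by (intro that) auto
  qed
qed

lemma blocks_at_0:
  assumes "q \<in> set blocks_at_0"
  shows "set q \<in> blocks" "0 \<in> set q"
proof -
  have "\<exists>p\<in>set ([0, 15, 30, 45] # base_blocks). \<exists>x\<in>set p.
      x \<noteq> 45 \<and> set q = shift (45 - x) ` set p"
  proof (cases "q = [0, 15, 30, 45]")
    case True
    then have "set q = shift (45 - 0) ` set [0, 15, 30, 45]"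
      by (simp add: shift_def)
    then show ?thesis
      by (intro bexI[of _ "[0, 15, 30, 45]"] bexI[of _ 0]) auto
  next
    case False
    then obtain p x where "p \<in> set base_blocks" "x \<in> set p" "x \<noteq> 45" "q = map (shift (45 - x)) p"
      using assms by (auto simp: blocks_at_0_def)
    then show ?thesis
      by (intro bexI[of _ p] bexI[of _ x]) auto
  qed
  then obtain p x where p: "p \<in> set ([0, 15, 30, 45] # base_blocks)"
    and x: "x \<in> set p" "x \<noteq> 45" and q: "set q = shift (45 - x) ` set p"
    by blast
  show "set q \<in> blocks"
    using p q by (auto simp: blocks_def)
  have "shift (45 - x) x = 0"
    using base_block_wf(1)[OF p] x by (auto simp: shift_def)
  then show "0 \<in> set q"
    using q x(1) by (metis imageI)
qed

section \<open>Unique block through a normal triple\<close>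

lemma set_codes: "set (codes q) = {46 * y + z | y z. y \<in> set q \<and> z \<in> set q \<and> normal_pair y z}"
  by (auto simp: codes_def)

lemma code_eq_iff:
  assumes "normal_pair y z" "normal_pair y' z'"
  shows "46 * y + z = 46 * y' + z' \<longleftrightarrow> y = y' \<and> z = z'"
proof -
  have "(46 * y + z) div 46 = y" "(46 * y' + z') div 46 = y'"
    using assms by (simp_all add: normal_pair_def)
  then show ?thesis
    by (metis add_left_cancel)
qed

lemma code_in_codes_iff:
  "normal_pair y z \<Longrightarrow> 46 * y + z \<in> set (codes q) \<longleftrightarrow> y \<in> set q \<and> z \<in> set q"
  unfolding set_codes using code_eq_iff by blast

text \<open>As a single map over a filtered product, the list inherits distinctness from
  \<open>distinct_product\<close> and the injectivity of the code.\<close>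

lemma codes_eq_map_product:
  "codes q = map (\<lambda>(y, z). 46 * y + z) (filter (\<lambda>(y, z). normal_pair y z) (List.product q q))"
proof -
  have "concat (map (\<lambda>y. map (\<lambda>z. 46 * y + z) (filter (normal_pair y) zs)) ys) =
      map (\<lambda>(y, z). 46 * y + z) (filter (\<lambda>(y, z). normal_pair y z) (List.product ys zs))" for ys zs
    by (induction ys) (simp_all add: filter_map comp_def)
  then show ?thesis
    by (simp add: codes_def)
qed

lemma distinct_codes: "distinct q \<Longrightarrow> distinct (codes q)"
  unfolding codes_eq_map_product
  by (auto simp: distinct_map distinct_product inj_on_def code_eq_iff)

lemma mset_all_codes: "mset (concat (map codes blocks_at_0)) = mset (codes [0..<46])"
proof -
  have "concat (map (\<lambda>k. [k]) ks) = ks" for ks :: "nat list"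
    by (induction ks) auto
  then show ?thesis
    by (metis merge_all_codes mset_merge_all)
qed

lemma distinct_concat_mapD:
  assumes "distinct (concat (map f xs))" "x \<in> set xs" "y \<in> set xs" "a \<in> set (f x)" "a \<in> set (f y)"
  shows "x = y"
  using assms by (induction xs) auto

text \<open>Existence is equality of the code sets. Uniqueness is distinctness of the concatenated
  list: a code coming from two different entries would occur twice.\<close>

lemma ex1_block_at_0:
  assumes "normal_pair y z"
  shows "\<exists>!b. b \<in> blocks \<and> {0, y, z} \<subseteq> b"
proof -
  have eq: "set (concat (map codes blocks_at_0)) = set (codes [0..<46])"
    by (rule mset_eq_setD[OF mset_all_codes])
  have "46 * y + z \<in> set (codes [0..<46])"
    using assms by (subst code_in_codes_iff) (auto simp: normal_pair_def)
  then obtain q where q: "q \<in> set blocks_at_0" "y \<in> set q" "z \<in> set q"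
    unfolding eq[symmetric] using assms by (auto simp: code_in_codes_iff)
  show ?thesis
  proof (rule ex1I)
    show "set q \<in> blocks \<and> {0, y, z} \<subseteq> set q"
      using q blocks_at_0 by auto
  next
    fix b assume b: "b \<in> blocks \<and> {0, y, z} \<subseteq> b"
    then obtain q' where q': "q' \<in> set blocks_at_0" "b = set q'"
      using in_blocks_at_0[of b] by auto
    have "distinct (concat (map codes blocks_at_0))"
      using mset_eq_imp_distinct_iff[OF mset_all_codes] distinct_codes by simp
    moreover have "46 * y + z \<in> set (codes q)" "46 * y + z \<in> set (codes q')"
      using b q q' assms by (auto simp: code_in_codes_iff)
    ultimately have "q = q'"
      using distinct_concat_mapD q(1) q'(1) by metis
    then show "b = set q"
      using q' by simp
  qed
qed

section \<open>Normal form of a triple\<close>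

lemma shift_diff:
  assumes "a < 45" "x < 45"
  shows "shift (45 - a) x = (if a \<le> x then x - a else 45 + x - a)"
proof (cases "a \<le> x")
  case True
  then have "x + (45 - a) = (x - a) + 45"
    using assms by simp
  then show ?thesis
    using True assms unfolding shift_def by (simp only: mod_add_self2) simp
qed (use assms in \<open>simp add: shift_def\<close>)

lemma normal_pair_gaps:
  assumes "a + b + c = 45" "0 < a" "0 < b" "0 < c"
  shows "normal_pair a (a + b) \<longleftrightarrow> a \<le> b \<and> a < c \<or> a = b \<and> b = c"
proof -
  have "a + b \<noteq> 45" "2 * a \<le> a + b \<longleftrightarrow> a \<le> b" "a + (a + b) < 45 \<longleftrightarrow> a < c"
     "a = 15 \<and> a + b = 30 \<longleftrightarrow> a = b \<and> b = c" "a + b \<le> 45"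
    using assms by linarith+
  then show ?thesis
    using assms unfolding normal_pair_def by simp
qed

text \<open>Start at the first gap of a cyclic run of smallest gaps: the gap before it is strictly
  larger, unless all three are equal.\<close>

lemma normal_pair_cyclic:
  assumes "a + b + c = 45" "0 < a" "0 < b" "0 < c"
  shows "normal_pair a (a + b) \<or> normal_pair b (b + c) \<or> normal_pair c (c + a)"
proof -
  have "a \<le> b \<and> a < c \<or> b \<le> c \<and> b < a \<or> c \<le> a \<and> c < b \<or> a = b \<and> b = c"
    by linarith
  then show ?thesis
    using assms normal_pair_gaps[of a b c] normal_pair_gaps[of b c a] normal_pair_gaps[of c a b]
    by (auto simp only: add.assoc add.commute add.left_commute)
qed

lemma triple_normal_form:
  assumes "p < q" "q < r" "r \<le> 45"
  obtains s y z where "normal_pair y z" "shift s ` {p, q, r} = {0, y, z}"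
proof (cases "r = 45")
  case True
  have "shift (45 - p) ` {p, q, r} = {0, q - p, 45}"
    and "shift (45 - q) ` {p, q, r} = {0, 45 + p - q, 45}"
    using assms True by (auto simp: shift_diff) (auto simp: shift_def)
  \<comment> \<open>The two differences add up to the odd number 45, so one of them is at most
    22.\<close>
  moreover have "normal_pair (q - p) 45 \<or> normal_pair (45 + p - q) 45"
    using assms True unfolding normal_pair_def by simp linarith
  ultimately show thesis
    using that by metis
next
  case False
  then have "r < 45"
    using assms by simp
  \<comment> \<open>Moving \<open>p\<close>, \<open>q\<close> or \<open>r\<close> to 0 rotates the
    gap sequence \<open>q - p\<close>, \<open>r - q\<close>, \<open>45 + p - r\<close>.\<close>
  have "shift (45 - p) ` {p, q, r} = {0, q - p, r - p}"
    and "shift (45 - q) ` {p, q, r} = {0, r - q, 45 + p - q}"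
    and "shift (45 - r) ` {p, q, r} = {0, 45 + p - r, 45 + q - r}"
    using assms \<open>r < 45\<close> by (auto simp: shift_diff)
  moreover have "normal_pair (q - p) (r - p) \<or> normal_pair (r - q) (45 + p - q)
    \<or> normal_pair (45 + p - r) (45 + q - r)"
  proof -
    have "(q - p) + (r - q) = r - p" "(r - q) + (45 + p - r) = 45 + p - q"
      "(45 + p - r) + (q - p) = 45 + q - r" "(q - p) + (r - q) + (45 + p - r) = 45"
      using assms by simp_all
    then show ?thesis
      using normal_pair_cyclic[of "q - p" "r - q" "45 + p - r"] assms \<open>r < 45\<close> by simp
  qed
  ultimately show thesis
    using that by metis
qed

section \<open>Steiner property for all triples\<close>

text \<open>Translations are invertible on the points and preserve \<open>blocks\<close>, so the
  unique block pulls back along \<open>shift s\<close>.\<close>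

lemma ex1_block:
  assumes T: "T \<subseteq> {..45}" and s: "\<exists>!b. b \<in> blocks \<and> shift s ` T \<subseteq> b"
  shows "\<exists>!b. b \<in> blocks \<and> T \<subseteq> b"
proof -
  have inv: "shift (44 * s) ` shift s ` A = A" if "A \<subseteq> {..45}" for A
  proof -
    have "shift (44 * s) ` shift s ` A = id ` A"
      unfolding image_image by (rule image_cong) (use that shift_inverse in auto)
    then show ?thesis
      by simp
  qed
  obtain b where b: "b \<in> blocks" "shift s ` T \<subseteq> b"
    and uniq: "\<And>c. c \<in> blocks \<Longrightarrow> shift s ` T \<subseteq> c \<Longrightarrow> c = b"
    using s by (elim ex1E) blast
  show ?thesis
  proof (rule ex1I)
    show "shift (44 * s) ` b \<in> blocks \<and> T \<subseteq> shift (44 * s) ` b"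
      using b shift_block inv[OF T] by (metis image_mono)
  next
    fix c assume c: "c \<in> blocks \<and> T \<subseteq> c"
    then have "shift s ` c = b"
      using uniq shift_block by (metis image_mono)
    then show "c = shift (44 * s) ` b"
      using inv[of c] block_wf(1) c by auto
  qed
qed

lemma card_3_nat_sorted:
  fixes T :: "nat set"
  assumes "card T = 3"
  obtains p q r where "T = {p, q, r}" "p < q" "q < r"
proof -
  have fin: "finite T"
    using assms by (intro card_ge_0_finite) simp
  define xs where "xs = sorted_list_of_set T"
  have xs: "length xs = 3" "set xs = T" "sorted_wrt (<) xs"
    using fin assms by (simp_all add: xs_def)
  then obtain p q r where "xs = [p, q, r]"
    by (auto simp: numeral_3_eq_3 length_Suc_conv)
  then show thesis
    using xs that by auto
qed

lemma SQS_blocks: "SQS 46 {..45} blocks"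
  unfolding steiner_system_def
proof (intro conjI allI impI)
  fix T :: "nat set" assume "T \<subseteq> {..45} \<and> card T = 3"
  then have T: "T \<subseteq> {..45}" "card T = 3"
    by auto
  obtain p q r where "T = {p, q, r}" "p < q" "q < r"
    using card_3_nat_sorted[OF T(2)] .
  then obtain s y z where "normal_pair y z" "shift s ` T = {0, y, z}"
    using T(1) by (elim triple_normal_form[of p q r]) auto
  then show "\<exists>!b. b \<in> blocks \<and> T \<subseteq> b"
    using ex1_block[OF T(1)] ex1_block_at_0 by metis
qed (use block_wf in auto)

section \<open>The rotational automorphism\<close>

text \<open>Agrees with \<open>shift 1\<close> on the points but is the identity beyond 45, as
  \<open>permutes\<close> demands.\<close>

definition rotation :: "nat \<Rightarrow> nat" where
  "rotation x = (if x < 45 then (x + 1) mod 45 else x)"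

lemma rotation_eq_shift: "x \<le> 45 \<Longrightarrow> rotation x = shift 1 x"
  by (auto simp: rotation_def shift_def)

lemma rotation_permutes: "rotation permutes {..45}"
proof (rule bij_imp_permutes)
  have "inj_on rotation {..45}"
    using inj_on_shift[of 1] by (subst inj_on_cong[OF rotation_eq_shift]) auto
  moreover have "rotation ` {..45} \<subseteq> {..45}"
    using shift_le by (auto simp: rotation_eq_shift)
  ultimately show "bij_betw rotation {..45} {..45}"
    by (simp add: bij_betw_def endo_inj_surj)
qed (simp add: rotation_def)

lemma rotation_cyclic: "cyclic_on rotation {..<45}"
proof -
  have step: "rotation k = Suc k" if "Suc k < 45" for k
    using that by (simp add: rotation_def)
  \<comment> \<open>\<open>orbit\<close> starts with the image \<open>rotation 0 = 1\<close>, so 1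
    to 44 are reached first; 0 itself is reached last, from 44.\<close>
  have pos: "Suc k \<in> orbit rotation 0" if "Suc k < 45" for k
    using that
  proof (induction k)
    case 0
    then show ?case
      using orbit.base[of rotation 0] step[of 0] by simp
  next
    case (Suc k)
    then show ?case
      using orbit.step[of "Suc k" rotation 0] step[of "Suc k"] by simp
  qed
  have "rotation (Suc 43) = 0"
    by (simp add: rotation_def)
  then have "0 \<in> orbit rotation 0"
    using orbit.step[OF pos[of 43]] by simp
  then have "k \<in> orbit rotation 0" if "k < 45" for k
    using that pos by (cases k) auto
  moreover have "k < 45" if "k \<in> orbit rotation 0" for k
    using that by induction (auto simp: rotation_def)
  ultimately have "orbit rotation 0 = {..<45}"
    by auto
  then show ?thesis
    unfolding cyclic_on_def by force
qed

theorem theorem1: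
  shows "\<exists>(X :: nat set) (B :: nat set set). RoSQS 46 X B"
proof -
  have "design_automorphism {..45} blocks rotation"
    unfolding design_automorphism_def
  proof (intro conjI ballI rotation_permutes)
    fix b assume b: "b \<in> blocks"
    have "rotation ` b = shift 1 ` b"
      using block_wf(1)[OF b] by (intro image_cong rotation_eq_shift) auto
    then show "rotation ` b \<in> blocks"
      using shift_block[OF b] by simp
  qed
  moreover have "{..45} - {45} = {..<45 :: nat}"
    by auto
  ultimately have "RoSQS 46 {..45} blocks"
    unfolding RoSQS_def using SQS_blocks rotation_cyclic
    by (intro conjI exI[of _ rotation] exI[of _ 45]) (auto simp: rotation_def)
  then show ?thesis
    by blast
qed

end
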